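(* Let $\lambda>\epsilon>0$, $q\in(0,1)$ and an integer $c\ge1$ be fixed, and let $\tilde\epsilon=\lambda/\lceil(c+1)\lambda/\epsilon\rceil$. Suppose an instance $\nu\in\mathcal E$ satisfies $\Delta(\nu,\lambda,\epsilon,c,q)=\max_{a\in\mathcal A_\epsilon(\nu)}\Delta_a=0$, where $\Delta_a=\Delta_a(\nu,\lambda,\epsilon,c,q)$ are the arm gaps. Suppose moreover that there exists $\eta_0>0$ such that $0\le Q_k^+(q-\eta_0)\le Q_k(q+\eta_0)\le\lambda$ for every arm $k$. Then $\nu$ is $c\tilde\epsilon$-unsolvable.
   Context: Setting. Arms $\mathcal A=\{1,\dots,K\}$ with $K\ge2$, level $q\in(0,1)$, $\lambda>0$. An instance is a tuple $\nu=(F_1,\dots,F_K)$ of CDFs on $\mathbb R$; each pull of arm $k$ yields an independent reward with CDF $F_k$. For real $p$ put $Q_k(p)=\sup\{x\in\mathbb R:F_k(x)<p\}$ and $Q_k^+(p)=\sup\{x\in\mathbb R:F_k(x)\le p\}$, with values in $[-\infty,\infty]$ ($\sup\varnothing=-\infty$ here). $\mathcal E$ is the set of instances with $Q_k(q)\in[0,\lambda]$ for every $k$. For $\epsilon'>0$, $\mathcal A_{\epsilon'}(\nu)=\{k: Q_k(q)\ge\max_{a}Q_a(q)-\epsilon'\}$. Solvability. An algorithm is a sequential, possibly randomized, adaptive rule which pulls arms one at a time, receives (quantized or unquantized) observations of the rewards, stops after a random number $\tau\in[0,\infty]$ of pulls, and upon stopping outputs an arm $\hat k$. It is $(\epsilon',\delta)$-reliable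 if $\mathbb P_{\nu'}[\tau<\infty\text{ and }\hat k\notin\mathcal A_{\epsilon'}(\nu')]\le\delta$ for every $\nu'\in\mathcal E$. An instance $\nu\in\mathcal E$ is $\epsilon'$-solvable if for each $\delta\in(0,1)$ there exists an $(\epsilon',\delta)$-reliable algorithm for which $\mathbb P_\nu[\tau<\infty\text{ and }\hat k\in\mathcal A_{\epsilon'}(\nu)]\ge1-\delta$; otherwise it is $\epsilon'$-unsolvable. Arm gaps, with $\mathcal A_\epsilon=\mathcal A_\epsilon(\nu)$. For $k\notin\mathcal A_\epsilon$, $$\Delta_k=\sup\Big\{\Delta\in[0,\min(q,1-q)]: Q_k(q+\Delta)\le\max_{a\in\mathcal A}Q_a^+(q-\Delta)-\tilde\epsilon\Big\}.$$ For $k\in\mathcal A_\epsilon$, $\Delta_k=\max_{\mathcal A_\epsilon\subseteq S\subseteq\mathcal A}\Delta_k^{(S)}$, where $$\Delta_k^{(S)}=\sup\Big\{\Delta\in\big[0,\min_{a\notin S}\Delta_a\big]: Q_k^+(q-\Delta)\ge\max_{a\in S\setminus\{k\}}Q_a(q+\Delta)-c\tilde\epsilon\Big\}.$$ Conventions: the minimum (maximum) of an empty set is $\infty$ ($-\infty$); the supremum of an empty set of values of $\Delta$ is $0$. *)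

theory Defs
  imports "HOL-Probability.Probability"
begin

section \<open>Quantiles and instances\<close>

definition is_cdf :: "(real \<Rightarrow> real) \<Rightarrow> bool" where
  "is_cdf F \<longleftrightarrow> mono F \<and> (\<forall>x. continuous (at_right x) F) \<and>
     (F \<longlongrightarrow> 0) at_bot \<and> (F \<longlongrightarrow> 1) at_top"

text \<open>
  Suprema are taken in \<^typ>\<open>ereal\<close>, where the supremum of the empty set is \<open>-\<infinity>\<close>.
  The level \<open>p\<close> may lie outside \<open>[0, 1]\<close>.
\<close>

definition quantile :: "(real \<Rightarrow> real) \<Rightarrow> real \<Rightarrow> ereal" where
  "quantile F p = Sup (ereal ` {x. F x < p})"

definition upper_quantile :: "(real \<Rightarrow> real) \<Rightarrow> real \<Rightarrow> ereal" where
  "upper_quantile F p = Sup (ereal ` {x. F x \<le> p})"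

text \<open>
  The arms are the elements of a finite type \<open>'k\<close>; an instance assigns a CDF to each arm.
\<close>

definition instances :: "real \<Rightarrow> real \<Rightarrow> ('k::finite \<Rightarrow> real \<Rightarrow> real) set" where
  "instances q lam =
     {\<nu>. \<forall>k. is_cdf (\<nu> k) \<and> 0 \<le> quantile (\<nu> k) q \<and> quantile (\<nu> k) q \<le> ereal lam}"

text \<open>
  Here and below, maxima and minima over finite sets of extended reals are written as
  \<open>SUP\<close> and \<open>INF\<close>: on nonempty finite sets they agree with maximum and minimum, and on the
  empty set they give \<open>-\<infinity>\<close> and \<open>\<infinity>\<close> respectively.
\<close>

definition good_arms :: "real \<Rightarrow> real \<Rightarrow> ('k::finite \<Rightarrow> real \<Rightarrow> real) \<Rightarrow> 'k set" where
  "good_arms q \<epsilon> \<nu> = {k. quantile (\<nu> k) q \<ge> (SUP a. quantile (\<nu> a) q) - ereal \<epsilon>}"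


section \<open>Algorithms\<close>

datatype 'k action = Pull 'k | Stop 'k

text \<open>
  All internal randomness of an algorithm is carried by one real-valued seed, drawn from
  \<open>seed_law\<close> and independent of the rewards; since every standard Borel space embeds into the
  reals, this covers fresh randomization before every pull.

  A pair \<open>(u, h)\<close> consists of the seed and the observations \<open>h 0, ..., h (t - 1)\<close> received
  in the first \<open>t\<close> pulls (\<open>h\<close> is \<open>undefined\<close> elsewhere). The arms pulled so far need not be
  recorded, as they are determined by \<open>(u, h)\<close>. Given this pair, \<open>decide t\<close> either names the arm
  to pull next or stops and outputs an arm, and \<open>observe t\<close> is the channel through which the reward
  of the next pull is seen: the identity gives unquantized observations, and a finitely valued
  map gives an (adaptively chosen) quantizer.
\<close>

record 'k algorithm =
  seed_law :: "real measure"
  decide :: "nat \<Rightarrow> real \<times> (nat \<Rightarrow> real) \<Rightarrow> 'k action"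
  observe :: "nat \<Rightarrow> real \<times> (nat \<Rightarrow> real) \<Rightarrow> real \<Rightarrow> real"

definition history_space :: "nat \<Rightarrow> (real \<times> (nat \<Rightarrow> real)) measure" where
  "history_space t = borel \<Otimes>\<^sub>M PiM {..<t} (\<lambda>_. borel)"

definition valid_algorithm :: "('k::finite) algorithm \<Rightarrow> bool" where
  "valid_algorithm alg \<longleftrightarrow>
     prob_space (seed_law alg) \<and> sets (seed_law alg) = sets borel \<and>
     (\<forall>t. decide alg t \<in> history_space t \<rightarrow>\<^sub>M count_space UNIV) \<and>
     (\<forall>t. case_prod (observe alg t) \<in> history_space t \<Otimes>\<^sub>M borel \<rightarrow>\<^sub>M borel)"

text \<open>
  The reward obtained if pull number \<open>t\<close> (counted from \<open>0\<close>) is made from arm \<open>k\<close> is \<open>X (t, k)\<close>;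
  all these rewards are independent, and \<open>X (t, k)\<close> has CDF \<open>\<nu> k\<close>.
\<close>

definition run_space ::
    "('k::finite) algorithm \<Rightarrow> ('k \<Rightarrow> real \<Rightarrow> real) \<Rightarrow> (real \<times> (nat \<times> 'k \<Rightarrow> real)) measure" where
  "run_space alg \<nu> = seed_law alg \<Otimes>\<^sub>M PiM UNIV (\<lambda>(t, k). interval_measure (\<nu> k))"

text \<open>The value \<open>0\<close> appended after stopping is a dummy; it does not affect the run.\<close>

primrec history :: "'k algorithm \<Rightarrow> real \<times> (nat \<times> 'k \<Rightarrow> real) \<Rightarrow> nat \<Rightarrow> (nat \<Rightarrow> real)" where
  "history alg \<omega> 0 = (\<lambda>_. undefined)"
| "history alg \<omega> (Suc t) = (history alg \<omega> t)(t :=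
     (case decide alg t (fst \<omega>, history alg \<omega> t) of
        Pull k \<Rightarrow> observe alg t (fst \<omega>, history alg \<omega> t) (snd \<omega> (t, k))
      | Stop k \<Rightarrow> 0))"

definition action_at :: "'k algorithm \<Rightarrow> real \<times> (nat \<times> 'k \<Rightarrow> real) \<Rightarrow> nat \<Rightarrow> 'k action" where
  "action_at alg \<omega> t = decide alg t (fst \<omega>, history alg \<omega> t)"

definition stop_time :: "'k algorithm \<Rightarrow> real \<times> (nat \<times> 'k \<Rightarrow> real) \<Rightarrow> enat" where
  "stop_time alg \<omega> = Inf (enat ` {t. \<exists>k. action_at alg \<omega> t = Stop k})"

text \<open>The output is meaningful only if the stopping time is finite.\<close>

definition output_arm :: "'k algorithm \<Rightarrow> real \<times> (nat \<times> 'k \<Rightarrow> real) \<Rightarrow> 'k" where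
  "output_arm alg \<omega> = (THE k. action_at alg \<omega> (the_enat (stop_time alg \<omega>)) = Stop k)"

definition prob_output_in ::
    "('k::finite) algorithm \<Rightarrow> ('k \<Rightarrow> real \<Rightarrow> real) \<Rightarrow> 'k set \<Rightarrow> real" where
  "prob_output_in alg \<nu> A =
     measure (run_space alg \<nu>)
       {\<omega> \<in> space (run_space alg \<nu>). stop_time alg \<omega> < \<infinity> \<and> output_arm alg \<omega> \<in> A}"


section \<open>Solvability\<close>

definition reliable ::
    "real \<Rightarrow> real \<Rightarrow> real \<Rightarrow> real \<Rightarrow> ('k::finite) algorithm \<Rightarrow> bool" where
  "reliable q lam \<epsilon> \<delta> alg \<longleftrightarrow>
     (\<forall>\<nu> \<in> instances q lam. prob_output_in alg \<nu> (- good_arms q \<epsilon> \<nu>) \<le> \<delta>)"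

definition solvable :: "real \<Rightarrow> real \<Rightarrow> real \<Rightarrow> ('k::finite \<Rightarrow> real \<Rightarrow> real) \<Rightarrow> bool" where
  "solvable q lam \<epsilon> \<nu> \<longleftrightarrow>
     (\<forall>\<delta>. 0 < \<delta> \<and> \<delta> < 1 \<longrightarrow>
        (\<exists>alg. valid_algorithm alg \<and> reliable q lam \<epsilon> \<delta> alg \<and>
           prob_output_in alg \<nu> (good_arms q \<epsilon> \<nu>) \<ge> 1 - \<delta>))"

definition unsolvable :: "real \<Rightarrow> real \<Rightarrow> real \<Rightarrow> ('k::finite \<Rightarrow> real \<Rightarrow> real) \<Rightarrow> bool" where
  "unsolvable q lam \<epsilon> \<nu> \<longleftrightarrow> \<nu> \<in> instances q lam \<and> \<not> solvable q lam \<epsilon> \<nu>"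


section \<open>Arm gaps\<close>

definition eps_tilde :: "real \<Rightarrow> real \<Rightarrow> int \<Rightarrow> real" where
  "eps_tilde lam \<epsilon> c = lam / of_int \<lceil>of_int (c + 1) * lam / \<epsilon>\<rceil>"

text \<open>
  Gaps are extended reals because the range of \<open>\<Delta>\<close> below may be unbounded. In contrast to
  quantiles, the supremum of an empty set of values of \<open>\<Delta>\<close> is \<open>0\<close>.
\<close>

definition gap_Sup :: "real set \<Rightarrow> ereal" where
  "gap_Sup D = (if D = {} then 0 else Sup (ereal ` D))"

definition gap_bad ::
    "real \<Rightarrow> real \<Rightarrow> real \<Rightarrow> int \<Rightarrow> ('k::finite \<Rightarrow> real \<Rightarrow> real) \<Rightarrow> 'k \<Rightarrow> ereal" where
  "gap_bad q lam \<epsilon> c \<nu> k =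
     gap_Sup {\<Delta>. 0 \<le> \<Delta> \<and> \<Delta> \<le> min q (1 - q) \<and>
       quantile (\<nu> k) (q + \<Delta>)
         \<le> (SUP a. upper_quantile (\<nu> a) (q - \<Delta>)) - ereal (eps_tilde lam \<epsilon> c)}"

text \<open>
  Only sets \<open>S\<close> containing all good arms are used below, so the arms outside \<open>S\<close> have
  gap \<open>gap_bad\<close>.
\<close>

definition gap_good_on ::
    "real \<Rightarrow> real \<Rightarrow> real \<Rightarrow> int \<Rightarrow> ('k::finite \<Rightarrow> real \<Rightarrow> real) \<Rightarrow> 'k set \<Rightarrow> 'k \<Rightarrow> ereal" where
  "gap_good_on q lam \<epsilon> c \<nu> S k =
     gap_Sup {\<Delta>. 0 \<le> \<Delta> \<and> ereal \<Delta> \<le> (INF a \<in> - S. gap_bad q lam \<epsilon> c \<nu> a) \<and>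
       upper_quantile (\<nu> k) (q - \<Delta>)
         \<ge> (SUP a \<in> S - {k}. quantile (\<nu> a) (q + \<Delta>)) - ereal (of_int c * eps_tilde lam \<epsilon> c)}"

definition arm_gap ::
    "real \<Rightarrow> real \<Rightarrow> real \<Rightarrow> int \<Rightarrow> ('k::finite \<Rightarrow> real \<Rightarrow> real) \<Rightarrow> 'k \<Rightarrow> ereal" where
  "arm_gap q lam \<epsilon> c \<nu> k =
     (if k \<in> good_arms q \<epsilon> \<nu>
      then (SUP S \<in> {S. good_arms q \<epsilon> \<nu> \<subseteq> S}. gap_good_on q lam \<epsilon> c \<nu> S k)
      else gap_bad q lam \<epsilon> c \<nu> k)"

definition instance_gap ::
    "real \<Rightarrow> real \<Rightarrow> real \<Rightarrow> int \<Rightarrow> ('k::finite \<Rightarrow> real \<Rightarrow> real) \<Rightarrow> ereal" where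
  "instance_gap q lam \<epsilon> c \<nu> = (SUP a \<in> good_arms q \<epsilon> \<nu>. arm_gap q lam \<epsilon> c \<nu> a)"

end

(* For k in A_eps, the case S = A of the gap condition says that for every Delta > 0 some arm a has
   Q_a(q + Delta) > Q_k^+(q - Delta) + c eps~. Mixing the law of arm k with a small point mass at
   Q_k^+(q - Delta), and that of arm a with one at Q_a(q + Delta), turns these numbers into the exact
   q-quantiles, so that k is no longer an acceptable output. Every mixture dominates (1 - theta)
   times the original law, where theta is the mass mixed in. Hence an event that depends on n rewards
   keeps at least the fraction (1 - theta)^n of its probability. A reliable algorithm therefore outputs
   k within its first T pulls with probability at most delta / (1 - theta)^(T K); letting theta tend
   to 0 first and T to infinity afterwards, it outputs each k in A_eps with probability at most
   delta. As c eps~ <= eps, every acceptable output lies in A_eps, so it succeeds with probability at most K delta < 1 - delta when delta = 1 / (K + 2). *)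

theory Submission
  imports Defs
begin

section \<open>Contaminated distributions\<close>

text \<open>The CDF of the mixture that draws from \<open>F\<close> with probability
  \<open>1 - \<theta>\<close> and returns the point \<open>x0\<close> otherwise.\<close>

definition contaminate :: "real \<Rightarrow> real \<Rightarrow> (real \<Rightarrow> real) \<Rightarrow> real \<Rightarrow> real" where
  "contaminate \<theta> x0 F x = (1 - \<theta>) * F x + (if x0 \<le> x then \<theta> else 0)"

lemma is_cdf_imp_real_distribution:
  assumes "is_cdf F"
  shows "real_distribution (interval_measure F)"
  using assms by (intro real_distribution_interval_measure) (auto simp: is_cdf_def dest: monoD)

lemma is_cdf_imp_cdf_interval_measure:
  assumes "is_cdf F"
  shows "cdf (interval_measure F) = F"
  using assms by (intro cdf_interval_measure) (auto simp: is_cdf_def dest: monoD)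

lemma is_cdf_contaminate:
  assumes F: "is_cdf F" and \<theta>: "0 \<le> \<theta>" "\<theta> \<le> 1"
  shows "is_cdf (contaminate \<theta> x0 F)"
  unfolding is_cdf_def
proof (intro conjI allI)
  show "mono (contaminate \<theta> x0 F)"
    unfolding contaminate_def using F \<theta>
    by (intro monoI add_mono mult_left_mono) (auto simp: is_cdf_def dest: monoD)
  have lim: "(F \<longlongrightarrow> 0) at_bot" "(F \<longlongrightarrow> 1) at_top" and rc: "\<And>x. continuous (at_right x) F"
    using F by (auto simp: is_cdf_def)
  have "((\<lambda>x. (1 - \<theta>) * F x) \<longlongrightarrow> (1 - \<theta>) * 0) at_bot"
    by (intro tendsto_intros lim)
  moreover have "\<forall>\<^sub>F x in at_bot. (1 - \<theta>) * F x = contaminate \<theta> x0 F x"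
    using eventually_gt_at_bot[of x0] by eventually_elim (simp add: contaminate_def)
  ultimately show "(contaminate \<theta> x0 F \<longlongrightarrow> 0) at_bot"
    by (simp add: tendsto_cong)
  have "((\<lambda>x. (1 - \<theta>) * F x + \<theta>) \<longlongrightarrow> (1 - \<theta>) * 1 + \<theta>) at_top"
    by (intro tendsto_intros lim)
  moreover have "\<forall>\<^sub>F x in at_top. (1 - \<theta>) * F x + \<theta> = contaminate \<theta> x0 F x"
    using eventually_ge_at_top[of x0] by eventually_elim (simp add: contaminate_def)
  ultimately show "(contaminate \<theta> x0 F \<longlongrightarrow> 1) at_top"
    by (simp add: tendsto_cong)
  fix x
  \<comment> \<open>The jump is locally constant to the right of every point; the weak inequality in
    \<open>contaminate\<close> makes this true at \<open>x0\<close> itself.\<close>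
  have "\<forall>\<^sub>F y in at_right x. (if x0 \<le> y then \<theta> else 0) = (if x0 \<le> x then \<theta> else 0)"
  proof (cases "x0 \<le> x")
    case True
    show ?thesis
      using eventually_at_right_less[of x] by eventually_elim (use True in auto)
  next
    case False
    then have "\<forall>\<^sub>F y in at_right x. y < x0"
      by (intro order_tendstoD(2)[OF tendsto_ident_at]) auto
    then show ?thesis
      by eventually_elim (use False in auto)
  qed
  then have "((\<lambda>y. if x0 \<le> y then \<theta> else 0) \<longlongrightarrow> (if x0 \<le> x then \<theta> else 0)) (at_right x)"
    by (rule tendsto_eventually)
  then show "continuous (at_right x) (contaminate \<theta> x0 F)"
    using rc[of x] unfolding contaminate_def continuous_within by (intro tendsto_intros)
qed

text \<open>Comparing CDFs says nothing directly about arbitrary Borel sets. The mixture is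
  therefore built as a measure, by tossing a Bernoulli coin and then using either a Dirac mass or
  \<open>F\<close>. Uniqueness of the measure with a given CDF identifies it with the contaminated
  law, and dropping the Dirac term gives the bound.\<close>

lemma emeasure_interval_measure_contaminate:
  assumes F: "is_cdf F" and \<theta>: "0 \<le> \<theta>" "\<theta> \<le> 1" and A: "A \<in> sets borel"
  shows "ennreal (1 - \<theta>) * emeasure (interval_measure F) A
           \<le> emeasure (interval_measure (contaminate \<theta> x0 F)) A"
proof -
  interpret F: real_distribution "interval_measure F"
    using F by (rule is_cdf_imp_real_distribution)
  define B where "B = measure_pmf (bernoulli_pmf \<theta>)"
  define g where "g b = (if b then return borel x0 else interval_measure F)" for b
  define M where "M = B \<bind> g"
  have g: "g \<in> B \<rightarrow>\<^sub>M prob_algebra borel"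
    by (auto simp: g_def B_def space_prob_algebra F.prob_space_axioms prob_space_return)
  have B: "B \<in> space (prob_algebra (count_space UNIV))"
    by (simp add: B_def space_prob_algebra prob_space_measure_pmf)
  have g': "g \<in> count_space UNIV \<rightarrow>\<^sub>M prob_algebra borel"
    using g by (simp add: B_def)
  have eM: "emeasure M X = ennreal \<theta> * indicator X x0
              + ennreal (1 - \<theta>) * emeasure (interval_measure F) X" if "X \<in> sets borel" for X
    unfolding M_def emeasure_bind_prob_algebra[OF B g' that]
    using \<theta> that by (simp add: B_def g_def mult.commute)
  have sM: "sets M = sets borel"
    unfolding M_def by (rule sets_bind'[OF B g'])
  interpret M: prob_space M
    unfolding M_def by (rule prob_space_bind'[OF B g'])
  have rM: "real_distribution M"
    by standard (use sM in simp_all)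
  have "cdf M = contaminate \<theta> x0 F"
  proof
    fix x
    have "ennreal (cdf M x) = emeasure M {..x}"
      by (simp add: cdf_def M.emeasure_eq_measure)
    also have "\<dots> = ennreal (\<theta> * indicator {..x} x0 + (1 - \<theta>) * cdf (interval_measure F) x)"
      using \<theta> by (simp add: eM cdf_def F.emeasure_eq_measure ennreal_mult' ennreal_indicator[symmetric])
    finally have "cdf M x = \<theta> * indicator {..x} x0 + (1 - \<theta>) * cdf (interval_measure F) x"
      using \<theta> by (subst (asm) ennreal_inj) (auto simp: cdf_def)
    then show "cdf M x = contaminate \<theta> x0 F x"
      by (simp add: is_cdf_imp_cdf_interval_measure[OF F] contaminate_def)
  qed
  then have eq: "interval_measure (contaminate \<theta> x0 F) = M"
    by (intro cdf_unique is_cdf_imp_real_distribution is_cdf_contaminate assms rM)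
      (simp add: is_cdf_imp_cdf_interval_measure is_cdf_contaminate assms)
  show ?thesis
    unfolding eq eM[OF A] by (rule add_increasing) simp_all
qed

text \<open>Left of \<open>x0\<close> the atom is absent, and scaling by \<open>1 - \<theta>\<close>
  pushes values below \<open>q + \<Delta>\<close> under \<open>q\<close> once
  \<open>(1 - \<theta>) * \<Delta> \<le> \<theta> * q\<close>. Right of \<open>x0\<close> the atom
  lifts values of at least \<open>q - \<Delta>\<close> to \<open>q\<close> once
  \<open>(1 - \<theta>) * \<Delta> \<le> \<theta> * (1 - q)\<close>. The bound
  \<open>\<theta> * q * (1 - q)\<close> on \<open>\<Delta>\<close> covers both.\<close>

lemma quantile_contaminate:
  assumes q: "0 < q" "q < 1" and \<theta>: "0 < \<theta>" "\<theta> < 1" and \<Delta>: "0 < \<Delta>" "\<Delta> \<le> \<theta> * q * (1 - q)"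
    and below: "\<And>x. x < x0 \<Longrightarrow> F x < q + \<Delta>" and above: "\<And>x. x0 < x \<Longrightarrow> q - \<Delta> \<le> F x"
  shows "quantile (contaminate \<theta> x0 F) q = ereal x0"
proof -
  have lt: "contaminate \<theta> x0 F x < q" if "x < x0" for x
  proof -
    have "(1 - \<theta>) * F x < (1 - \<theta>) * (q + \<Delta>)"
      using below[OF that] \<theta> by simp
    also have "\<dots> \<le> (1 - \<theta>) * (q + \<theta> * q * (1 - q))"
      using \<Delta> \<theta> by (intro mult_left_mono) auto
    also have "\<dots> = q - \<theta> * q * (q + \<theta> * (1 - q))"
      by (simp add: algebra_simps)
    also have "\<dots> \<le> q"
      using q \<theta> by simp
    finally show ?thesis
      using that by (simp add: contaminate_def)
  qed
  have ge: "q \<le> contaminate \<theta> x0 F x" if "x0 < x" for x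
  proof -
    have "q \<le> q + \<theta> * (1 - q) * ((1 - q) + \<theta> * q)"
      using q \<theta> by simp
    also have "\<dots> = (1 - \<theta>) * (q - \<theta> * q * (1 - q)) + \<theta>"
      by (simp add: algebra_simps)
    also have "\<dots> \<le> (1 - \<theta>) * (q - \<Delta>) + \<theta>"
      using \<Delta> \<theta> by (intro add_right_mono mult_left_mono) auto
    also have "\<dots> \<le> (1 - \<theta>) * F x + \<theta>"
      using above[OF that] \<theta> by simp
    finally show ?thesis
      using that by (simp add: contaminate_def)
  qed
  show ?thesis
    unfolding quantile_def
  proof (rule antisym)
    show "Sup (ereal ` {x. contaminate \<theta> x0 F x < q}) \<le> ereal x0"
    proof (rule Sup_least)
      fix y assume "y \<in> ereal ` {x. contaminate \<theta> x0 F x < q}"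
      then obtain x where "y = ereal x" "contaminate \<theta> x0 F x < q"
        by auto
      then show "y \<le> ereal x0"
        using ge[of x] by (cases "x0 < x") auto
    qed
    show "ereal x0 \<le> Sup (ereal ` {x. contaminate \<theta> x0 F x < q})"
    \<comment> \<open>Nothing is known about the value at \<open>x0\<close> itself, so
      \<open>x0\<close> is approached by real points strictly below it.\<close>
    proof (rule dense_le)
      fix y assume "y < ereal x0"
      then obtain z where "y < ereal z" "z < x0"
        using ereal_dense2[of y "ereal x0"] by auto
      then show "y \<le> Sup (ereal ` {x. contaminate \<theta> x0 F x < q})"
        using lt by (intro Sup_upper2[of "ereal z"]) auto
    qed
  qed
qed

section \<open>Monotonicity of quantiles, and passage from quantile bounds to CDF bounds\<close>

lemma quantile_mono: "p \<le> p' \<Longrightarrow> quantile F p \<le> quantile F p'"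
  unfolding quantile_def by (intro Sup_subset_mono) auto

lemma upper_quantile_mono: "p \<le> p' \<Longrightarrow> upper_quantile F p \<le> upper_quantile F p'"
  unfolding upper_quantile_def by (intro Sup_subset_mono) auto

lemma upper_quantile_le_quantile: "p < p' \<Longrightarrow> upper_quantile F p \<le> quantile F p'"
  unfolding upper_quantile_def quantile_def by (intro Sup_subset_mono) auto

lemma less_quantileD:
  assumes "mono F" "ereal x < quantile F p"
  shows "F x < p"
proof -
  obtain y where "F y < p" "x < y"
    using assms(2) by (auto simp: quantile_def less_Sup_iff)
  then show ?thesis
    using monoD[OF assms(1), of x y] by simp
qed

lemma quantile_lessD: "quantile F p < ereal x \<Longrightarrow> p \<le> F x"
  by (metis (mono_tags, lifting) Sup_upper image_eqI leD leI mem_Collect_eq quantile_def)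

lemma less_upper_quantileD:
  assumes "mono F" "ereal x < upper_quantile F p"
  shows "F x \<le> p"
proof -
  obtain y where "F y \<le> p" "x < y"
    using assms(2) by (auto simp: upper_quantile_def less_Sup_iff)
  then show ?thesis
    using monoD[OF assms(1), of x y] by simp
qed

lemma upper_quantile_lessD: "upper_quantile F p < ereal x \<Longrightarrow> p < F x"
  by (metis (mono_tags, lifting) Sup_upper image_eqI leD leI mem_Collect_eq upper_quantile_def)


section \<open>Domination of product measures\<close>

text \<open>Fubini, one coordinate at a time, each costing a factor \<open>r\<close>. Integrals
  rather than sets are compared because integrating out one coordinate of an indicator leaves a
  general function of the others, to which the induction hypothesis must apply.\<close>

lemma nn_integral_PiM_dominated:
  fixes M N :: "'i \<Rightarrow> 'a measure"
  assumes "finite J"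
    and M: "\<And>i. prob_space (M i)" and N: "\<And>i. prob_space (N i)"
    and sets: "\<And>i. sets (N i) = sets (M i)"
    and dom: "\<And>i A. A \<in> sets (M i) \<Longrightarrow> r * emeasure (M i) A \<le> emeasure (N i) A"
    and "f \<in> borel_measurable (PiM J M)"
  shows "r ^ card J * (\<integral>\<^sup>+x. f x \<partial>PiM J M) \<le> (\<integral>\<^sup>+x. f x \<partial>PiM J N)"
  using assms(1,6)
proof (induction J arbitrary: f)
  case empty
  have "PiM {} M = PiM {} N"
    using sets by (intro PiM_cong refl) auto
  then show ?case by simp
next
  case (insert i J)
  interpret M: product_sigma_finite M
    by (rule product_sigma_finite.intro) (simp add: M prob_space_imp_sigma_finite)
  interpret N: product_sigma_finite N
    by (rule product_sigma_finite.intro) (simp add: N prob_space_imp_sigma_finite)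
  have sP: "sets (PiM I N) = sets (PiM I M)" for I
    by (rule sets_PiM_cong) (simp_all add: sets)
  have dom': "r * (\<integral>\<^sup>+y. g y \<partial>M i) \<le> (\<integral>\<^sup>+y. g y \<partial>N i)"
    if "g \<in> borel_measurable (M i)" for g
  proof -
    have "r * (\<integral>\<^sup>+y. g y \<partial>M i) = (\<integral>\<^sup>+y. g y \<partial>scale_measure r (M i))"
      using that by (simp add: nn_integral_scale_measure)
    also have "\<dots> \<le> (\<integral>\<^sup>+y. g y \<partial>N i)"
    proof (rule nn_integral_mono_measure)
      \<comment> \<open>Both measures have the same measurable sets, so their order is the pointwise
        one; on nonmeasurable sets both sides are 0.\<close>
      show "scale_measure r (M i) \<le> N i"
        by (subst le_measure) (auto simp: sets le_fun_def emeasure_notin_sets dom)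
    qed (simp add: sets)
    finally show ?thesis .
  qed
  have fM[measurable]: "f \<in> borel_measurable (PiM (insert i J) M)"
    by fact
  have fN: "f \<in> borel_measurable (PiM (insert i J) N)"
    using fM by (simp cong: measurable_cong_sets add: sP)
  have meas[measurable]: "(\<lambda>(x, y). f (x(i := y))) \<in> borel_measurable (PiM J M \<Otimes>\<^sub>M M i)"
    using measurable_compose[OF measurable_add_dim fM] by (simp add: split_beta')
  interpret Mi: prob_space "M i" by (rule M)
  have "r ^ card (insert i J) * (\<integral>\<^sup>+x. f x \<partial>PiM (insert i J) M)
      = r ^ card J * (\<integral>\<^sup>+x. r * (\<integral>\<^sup>+y. f (x(i := y)) \<partial>M i) \<partial>PiM J M)"
    using insert.hyps
    by (subst M.product_nn_integral_insert) (simp_all add: nn_integral_cmult mult_ac)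
  also have "\<dots> \<le> (\<integral>\<^sup>+x. r * (\<integral>\<^sup>+y. f (x(i := y)) \<partial>M i) \<partial>PiM J N)"
    by (rule insert.IH) measurable
  also have "\<dots> \<le> (\<integral>\<^sup>+x. (\<integral>\<^sup>+y. f (x(i := y)) \<partial>N i) \<partial>PiM J N)"
  proof (rule nn_integral_mono)
    fix x assume "x \<in> space (PiM J N)"
    then have "x \<in> space (PiM J M)"
      using sets_eq_imp_space_eq[OF sP] by simp
    then show "r * (\<integral>\<^sup>+y. f (x(i := y)) \<partial>M i) \<le> (\<integral>\<^sup>+y. f (x(i := y)) \<partial>N i)"
      using measurable_compose[OF measurable_Pair1' meas] by (intro dom') simp
  qed
  also have "\<dots> = (\<integral>\<^sup>+x. f x \<partial>PiM (insert i J) N)"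
    using insert.hyps by (subst N.product_nn_integral_insert) (simp_all add: fN)
  finally show ?case .
qed

text \<open>Only cylinders over a finite \<open>J\<close> are compared: the loss is one factor
  \<open>r\<close> per coordinate on which the event depends, so the bound reduces to the product
  over \<open>J\<close>.\<close>

lemma emeasure_PiM_emb_dominated:
  fixes M N :: "'i \<Rightarrow> 'a measure"
  assumes J: "finite J"
    and M: "\<And>i. prob_space (M i)" and N: "\<And>i. prob_space (N i)"
    and sets: "\<And>i. sets (N i) = sets (M i)"
    and dom: "\<And>i A. A \<in> sets (M i) \<Longrightarrow> r * emeasure (M i) A \<le> emeasure (N i) A"
    and X: "X \<in> sets (PiM J M)"
  shows "r ^ card J * emeasure (PiM UNIV M) (prod_emb UNIV M J X)
           \<le> emeasure (PiM UNIV N) (prod_emb UNIV M J X)"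
proof -
  interpret M: product_prob_space M UNIV
    by (simp add: M product_prob_spaceI)
  interpret N: product_prob_space N UNIV
    by (simp add: N product_prob_spaceI)
  have sP: "sets (PiM J N) = sets (PiM J M)"
    by (rule sets_PiM_cong) (simp_all add: sets)
  have "prod_emb UNIV M J X = prod_emb UNIV N J X"
    using sets_eq_imp_space_eq[OF sets] by (simp add: prod_emb_def)
  then have "emeasure (PiM UNIV N) (prod_emb UNIV M J X) = emeasure (PiM J N) X"
    using J X by (simp add: N.emeasure_PiM_emb' sP)
  then show ?thesis
    using nn_integral_PiM_dominated[where M = M and N = N and J = J and f = "indicator X",
        OF J M N sets dom] J X
    by (simp add: M.emeasure_PiM_emb' sP)
qed


section \<open>Runs of an algorithm\<close>

text \<open>Isolates the part of the output event that is decided by time \<open>t\<close>. The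
  history formally continues after stopping and may meet further \<open>Stop\<close> actions, so the
  clause on earlier times singles out the first one.\<close>

definition outputs_at :: "'k algorithm \<Rightarrow> 'k \<Rightarrow> nat \<Rightarrow> real \<times> (nat \<times> 'k \<Rightarrow> real) \<Rightarrow> bool" where
  "outputs_at alg k t \<omega> \<longleftrightarrow>
     action_at alg \<omega> t = Stop k \<and> (\<forall>s<t. \<forall>j. action_at alg \<omega> s \<noteq> Stop j)"

lemma output_arm_iff_outputs_at:
  "stop_time alg \<omega> < \<infinity> \<and> output_arm alg \<omega> = k \<longleftrightarrow> (\<exists>t. outputs_at alg k t \<omega>)"
proof -
  define P where "P t \<longleftrightarrow> (\<exists>k. action_at alg \<omega> t = Stop k)" for t
  have st: "stop_time alg \<omega> = enat t" if "P t" "\<And>s. s < t \<Longrightarrow> \<not> P s" for t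
    unfolding stop_time_def
  proof (rule antisym)
    show "Inf (enat ` {t. \<exists>k. action_at alg \<omega> t = Stop k}) \<le> enat t"
      using that by (intro Inf_lower) (auto simp: P_def)
    show "enat t \<le> Inf (enat ` {t. \<exists>k. action_at alg \<omega> t = Stop k})"
      using that by (intro Inf_greatest) (auto simp: P_def not_less[symmetric])
  qed
  show ?thesis
  proof (cases "\<exists>t. P t")
    case True
    define t where "t = (LEAST t. P t)"
    have t: "P t" "\<And>s. s < t \<Longrightarrow> \<not> P s"
      using True not_less_Least by (auto simp: t_def intro: LeastI_ex)
    from t(1) obtain j where j: "action_at alg \<omega> t = Stop j"
      by (auto simp: P_def)
    have "output_arm alg \<omega> = j"
      using st[OF t] j by (simp add: output_arm_def)
    moreover have "outputs_at alg k s \<omega> \<longleftrightarrow> s = t \<and> k = j" for s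
      using t j by (cases s t rule: linorder_cases) (auto simp: outputs_at_def P_def)
    ultimately show ?thesis
      using st[OF t] by auto
  next
    case False
    then have "stop_time alg \<omega> = \<infinity>"
      by (simp add: stop_time_def P_def top_enat_def)
    then show ?thesis
      using False by (auto simp: outputs_at_def P_def)
  qed
qed

section \<open>Dependence on finitely many rewards, and measurability of runs\<close>

lemma history_cong:
  assumes "\<And>s k. s < t \<Longrightarrow> x (s, k) = y (s, k)"
  shows "history alg (u, x) t = history alg (u, y) t"
  using assms
proof (induction t)
  case (Suc t)
  have eq: "history alg (u, x) t = history alg (u, y) t"
    by (rule Suc.IH) (simp add: Suc.prems)
  show ?case
    by (rule ext) (simp add: eq Suc.prems split: action.split)
qed simp

text \<open>The decision at time \<open>t\<close> precedes pull number \<open>t\<close>, so it is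
  fixed by the seed and the rewards with index strictly below \<open>t\<close>.\<close>

lemma outputs_at_cong:
  assumes "\<And>s k. s < t \<Longrightarrow> x (s, k) = y (s, k)"
  shows "outputs_at alg k t (u, x) = outputs_at alg k t (u, y)"
proof -
  have "action_at alg (u, x) s = action_at alg (u, y) s" if "s \<le> t" for s
    using that assms history_cong[of s x y alg u] by (simp add: action_at_def)
  then show ?thesis
    by (simp add: outputs_at_def)
qed

text \<open>Shows that finitely many arms leave only finitely many actions, which permits a case
  split by action in the measurability proof.\<close>

lemma UNIV_action: "(UNIV :: 'k action set) = range Pull \<union> range Stop"
proof (intro set_eqI iffI UNIV_I)
  fix a :: "'k action"
  show "a \<in> range Pull \<union> range Stop"
    by (cases a) auto
qed

context
  fixes alg :: "('k::finite) algorithm" and S :: "real measure"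
    and M :: "nat \<times> 'k \<Rightarrow> real measure" and J :: "(nat \<times> 'k) set" and T :: nat
  assumes alg: "valid_algorithm alg"
    and S: "sets S = sets borel" and M: "\<And>i. sets (M i) = sets borel"
    and J: "{..<T} \<times> UNIV \<subseteq> J"
begin

lemma measurable_history_Pair:
  assumes h: "(\<lambda>\<omega>. history alg \<omega> t) \<in> S \<Otimes>\<^sub>M PiM J M \<rightarrow>\<^sub>M PiM {..<t} (\<lambda>_. borel)"
  shows "(\<lambda>\<omega>. (fst \<omega>, history alg \<omega> t)) \<in> S \<Otimes>\<^sub>M PiM J M \<rightarrow>\<^sub>M history_space t"
proof -
  have "fst \<in> S \<Otimes>\<^sub>M PiM J M \<rightarrow>\<^sub>M borel"
    using S measurable_fst by (simp cong: measurable_cong_sets)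
  then show ?thesis
    unfolding history_space_def by (intro measurable_Pair h)
qed

lemma measurable_history:
  "t \<le> T \<Longrightarrow> (\<lambda>\<omega>. history alg \<omega> t) \<in> S \<Otimes>\<^sub>M PiM J M \<rightarrow>\<^sub>M PiM {..<t} (\<lambda>_. borel)"
proof (induction t)
  case 0
  show ?case
    by (simp add: PiM_empty)
next
  case (Suc t)
  let ?R = "S \<Otimes>\<^sub>M PiM J M"
  have h: "(\<lambda>\<omega>. history alg \<omega> t) \<in> ?R \<rightarrow>\<^sub>M PiM {..<t} (\<lambda>_. borel)"
    using Suc by simp
  have H: "(\<lambda>\<omega>. (fst \<omega>, history alg \<omega> t)) \<in> ?R \<rightarrow>\<^sub>M history_space t"
    by (rule measurable_history_Pair[OF h])
  have D: "(\<lambda>\<omega>. decide alg t (fst \<omega>, history alg \<omega> t)) \<in> ?R \<rightarrow>\<^sub>M count_space UNIV"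
    using alg by (intro measurable_compose[OF H]) (auto simp: valid_algorithm_def)
  have X: "(\<lambda>\<omega>. snd \<omega> (t, k)) \<in> ?R \<rightarrow>\<^sub>M borel" for k
  proof -
    have "(t, k) \<in> J"
      using J Suc.prems by auto
    then have "(\<lambda>\<omega>. snd \<omega> (t, k)) \<in> ?R \<rightarrow>\<^sub>M M (t, k)"
      by measurable
    then show ?thesis
      by (simp add: M cong: measurable_cong_sets)
  qed
  have O: "(\<lambda>\<omega>. observe alg t (fst \<omega>, history alg \<omega> t) (snd \<omega> (t, k))) \<in> ?R \<rightarrow>\<^sub>M borel" for k
  proof -
    have "case_prod (observe alg t) \<in> history_space t \<Otimes>\<^sub>M borel \<rightarrow>\<^sub>M borel"
      using alg by (auto simp: valid_algorithm_def)
    from measurable_compose[OF measurable_Pair[OF H X] this] show ?thesis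
      by simp
  qed
  \<comment> \<open>Which reward is read depends on the run through the chosen action. That action
    is a measurable function with countably many values, so measurability for each fixed action
    suffices.\<close>
  have "(\<lambda>\<omega>. (\<lambda>a \<omega>. case a of Pull k \<Rightarrow> observe alg t (fst \<omega>, history alg \<omega> t) (snd \<omega> (t, k))
                  | Stop k \<Rightarrow> 0) (decide alg t (fst \<omega>, history alg \<omega> t)) \<omega>) \<in> ?R \<rightarrow>\<^sub>M borel"
  proof (rule measurable_compose_countable'[OF _ D])
    show "countable (UNIV :: 'k action set)"
      unfolding UNIV_action by (intro countable_finite) simp
    fix a :: "'k action"
    show "(\<lambda>\<omega>. case a of Pull k \<Rightarrow> observe alg t (fst \<omega>, history alg \<omega> t) (snd \<omega> (t, k))
               | Stop k \<Rightarrow> 0) \<in> ?R \<rightarrow>\<^sub>M borel"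
      using O by (cases a) auto
  qed
  from measurable_compose[OF measurable_Pair[OF h this[simplified]]
      measurable_add_dim[where M = "\<lambda>_. borel" and i = t]]
  show ?case
    by (simp add: lessThan_Suc fun_upd_def)
qed

text \<open>The index set \<open>J\<close> stays general since two cases arise later: all rewards,
  and those of the first \<open>T\<close> rounds only.\<close>

lemma sets_outputs_at:
  assumes "t < T"
  shows "{\<omega> \<in> space (S \<Otimes>\<^sub>M PiM J M). outputs_at alg k t \<omega>} \<in> sets (S \<Otimes>\<^sub>M PiM J M)"
proof -
  have A: "{\<omega> \<in> space (S \<Otimes>\<^sub>M PiM J M). action_at alg \<omega> s \<in> B} \<in> sets (S \<Otimes>\<^sub>M PiM J M)"
    if "s < T" for s B
  proof -
    have "(\<lambda>\<omega>. decide alg s (fst \<omega>, history alg \<omega> s)) \<in> S \<Otimes>\<^sub>M PiM J M \<rightarrow>\<^sub>M count_space UNIV"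
      using alg that
      by (intro measurable_compose[OF measurable_history_Pair[OF measurable_history]])
        (auto simp: valid_algorithm_def)
    then have "(\<lambda>\<omega>. action_at alg \<omega> s) \<in> S \<Otimes>\<^sub>M PiM J M \<rightarrow>\<^sub>M count_space UNIV"
      by (simp add: action_at_def)
    from measurable_sets[OF this, of B] show ?thesis
      by (simp add: vimage_def Int_def conj_commute)
  qed
  have "{\<omega> \<in> space (S \<Otimes>\<^sub>M PiM J M). outputs_at alg k t \<omega>} =
      {\<omega> \<in> space (S \<Otimes>\<^sub>M PiM J M). action_at alg \<omega> t \<in> {Stop k} \<and>
         (\<forall>s\<in>{..<t}. action_at alg \<omega> s \<in> - range Stop)}"
    by (auto simp: outputs_at_def)
  also have "\<dots> \<in> sets (S \<Otimes>\<^sub>M PiM J M)"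
    using assms by (intro sets.sets_Collect_conj sets.sets_Collect_finite_All A) auto
  finally show ?thesis .
qed

end

section \<open>Output probabilities under one instance, and their comparison between two\<close>

lemma prob_space_reward:
  assumes "\<And>k. is_cdf (\<nu> k)"
  shows "prob_space ((\<lambda>(t, k). interval_measure (\<nu> k)) i)"
  using is_cdf_imp_real_distribution[OF assms] by (auto simp: real_distribution_def split: prod.split)

context
  fixes alg :: "('k::finite) algorithm" and \<nu> :: "'k \<Rightarrow> real \<Rightarrow> real"
  assumes alg: "valid_algorithm alg" and \<nu>: "\<And>k. is_cdf (\<nu> k)"
begin

lemma prob_space_run_space: "prob_space (run_space alg \<nu>)"
proof -
  interpret rewards: prob_space "PiM UNIV (\<lambda>(t::nat, k). interval_measure (\<nu> k))"
    by (intro prob_space_PiM prob_space_reward \<nu>)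
  interpret seed: prob_space "seed_law alg"
    using alg by (simp add: valid_algorithm_def)
  interpret pair_prob_space "seed_law alg" "PiM UNIV (\<lambda>(t::nat, k). interval_measure (\<nu> k))" ..
  show ?thesis
    unfolding run_space_def by (rule prob_space_axioms)
qed

lemma sets_run_space_outputs_at:
  "{\<omega> \<in> space (run_space alg \<nu>). outputs_at alg k t \<omega>} \<in> sets (run_space alg \<nu>)"
  unfolding run_space_def
  by (rule sets_outputs_at[where T = "Suc t"])
    (use alg in \<open>auto simp: valid_algorithm_def split: prod.split\<close>)

lemma sets_run_space_output:
  "{\<omega> \<in> space (run_space alg \<nu>). stop_time alg \<omega> < \<infinity> \<and> output_arm alg \<omega> \<in> A}
     \<in> sets (run_space alg \<nu>)"
proof -
  have "{\<omega> \<in> space (run_space alg \<nu>). stop_time alg \<omega> < \<infinity> \<and> output_arm alg \<omega> \<in> A} =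
      {\<omega> \<in> space (run_space alg \<nu>). \<exists>k\<in>A. \<exists>t. outputs_at alg k t \<omega>}"
    unfolding output_arm_iff_outputs_at[symmetric] by blast
  also have "\<dots> \<in> sets (run_space alg \<nu>)"
    by (intro sets.sets_Collect_finite_Ex sets.sets_Collect_countable_Ex sets_run_space_outputs_at)
      simp
  finally show ?thesis .
qed

lemma prob_output_in_mono: "A \<subseteq> B \<Longrightarrow> prob_output_in alg \<nu> A \<le> prob_output_in alg \<nu> B"
proof -
  interpret prob_space "run_space alg \<nu>"
    by (rule prob_space_run_space)
  show "A \<subseteq> B \<Longrightarrow> prob_output_in alg \<nu> A \<le> prob_output_in alg \<nu> B"
    unfolding prob_output_in_def by (intro finite_measure_mono sets_run_space_output) auto
qed

lemma prob_output_in_le_sum: "prob_output_in alg \<nu> A \<le> (\<Sum>k\<in>A. prob_output_in alg \<nu> {k})"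
proof -
  interpret prob_space "run_space alg \<nu>"
    by (rule prob_space_run_space)
  let ?E = "\<lambda>A. {\<omega> \<in> space (run_space alg \<nu>). stop_time alg \<omega> < \<infinity> \<and> output_arm alg \<omega> \<in> A}"
  have "?E A = (\<Union>k\<in>A. ?E {k})"
    by auto
  then have "prob (?E A) = prob (\<Union>k\<in>A. ?E {k})"
    by (rule arg_cong)
  also have "\<dots> \<le> (\<Sum>k\<in>A. prob (?E {k}))"
  proof (rule finite_measure_subadditive_finite)
    show "(\<lambda>k. ?E {k}) ` A \<subseteq> events"
      by (intro image_subsetI sets_run_space_output)
  qed simp
  finally show ?thesis
    by (simp only: prob_output_in_def)
qed

text \<open>Continuity from below: the events of outputting \<open>k\<close> before time
  \<open>T\<close> increase to the event of ever outputting \<open>k\<close>. This reduces the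
  problem to finite horizons, where domination of product laws is available.\<close>

lemma prob_output_in_singleton_le:
  assumes "\<And>T. measure (run_space alg \<nu>)
                 {\<omega> \<in> space (run_space alg \<nu>). \<exists>t\<in>{..<T}. outputs_at alg k t \<omega>} \<le> \<delta>"
  shows "prob_output_in alg \<nu> {k} \<le> \<delta>"
proof -
  interpret prob_space "run_space alg \<nu>"
    by (rule prob_space_run_space)
  let ?E = "\<lambda>T. {\<omega> \<in> space (run_space alg \<nu>). \<exists>t\<in>{..<T}. outputs_at alg k t \<omega>}"
  have sets: "?E T \<in> sets (run_space alg \<nu>)" for T
    by (intro sets.sets_Collect_finite_Ex sets_run_space_outputs_at) simp
  have "(\<lambda>T. measure (run_space alg \<nu>) (?E T)) \<longlonglongrightarrow> measure (run_space alg \<nu>) (\<Union>T. ?E T)"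
  proof (rule finite_Lim_measure_incseq)
    show "range ?E \<subseteq> events"
      using sets by blast
    show "incseq ?E"
      by (rule incseq_SucI) (auto intro: less_SucI)
  qed
  moreover have "(\<Union>T. ?E T) =
      {\<omega> \<in> space (run_space alg \<nu>). stop_time alg \<omega> < \<infinity> \<and> output_arm alg \<omega> \<in> {k}}"
  proof -
    have "(\<exists>t. outputs_at alg k t \<omega>) \<longleftrightarrow> (\<exists>T. \<exists>t\<in>{..<T}. outputs_at alg k t \<omega>)" for \<omega>
      by (metis lessI lessThan_iff)
    then show ?thesis
      unfolding singleton_iff output_arm_iff_outputs_at by blast
  qed
  ultimately show ?thesis
    unfolding prob_output_in_def by (intro LIMSEQ_le_const2[where a = \<delta>]) (auto simp: assms)
qed

end

text \<open>The seed has the same law under both instances, so it can be fixed. The event is then a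
  cylinder over the potential rewards of all arms in the first \<open>T\<close> rounds, hence the
  exponent \<open>T * CARD('k)\<close>. Integrating over the seed finishes the comparison.\<close>

lemma measure_run_space_outputs_dominated:
  fixes alg :: "('k::finite) algorithm"
  assumes alg: "valid_algorithm alg"
    and \<nu>: "\<And>k. is_cdf (\<nu> k)" and \<nu>': "\<And>k. is_cdf (\<nu>' k)" and r: "0 \<le> r"
    and dom: "\<And>k A. A \<in> sets borel \<Longrightarrow>
        ennreal r * emeasure (interval_measure (\<nu> k)) A \<le> emeasure (interval_measure (\<nu>' k)) A"
  shows "r ^ (T * CARD('k)) * measure (run_space alg \<nu>)
             {\<omega> \<in> space (run_space alg \<nu>). \<exists>t\<in>{..<T}. outputs_at alg k t \<omega>}
           \<le> prob_output_in alg \<nu>' {k}"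
proof -
  let ?M = "\<lambda>\<nu>. \<lambda>(t::nat, k::'k). interval_measure (\<nu> k)"
  let ?J = "{..<T} \<times> (UNIV :: 'k set)"
  let ?E = "{\<omega> \<in> space (run_space alg \<nu>). \<exists>t\<in>{..<T}. outputs_at alg k t \<omega>}"
  interpret R: prob_space "run_space alg \<nu>"
    by (intro prob_space_run_space alg \<nu>)
  interpret R': prob_space "run_space alg \<nu>'"
    by (intro prob_space_run_space alg \<nu>')
  interpret P: prob_space "PiM UNIV (?M \<nu>)"
    by (intro prob_space_PiM prob_space_reward \<nu>)
  interpret P': prob_space "PiM UNIV (?M \<nu>')"
    by (intro prob_space_PiM prob_space_reward \<nu>')
  have setsM: "sets (?M \<nu> i) = sets borel" for \<nu> i
    by (simp split: prod.split)
  have seed: "sets (seed_law alg) = sets borel"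
    using alg by (simp add: valid_algorithm_def)
  have sP: "sets (PiM UNIV (?M \<nu>')) = sets (PiM UNIV (?M \<nu>))"
    by (intro sets_PiM_cong refl) (simp add: setsM)
  have sR: "sets (run_space alg \<nu>') = sets (run_space alg \<nu>)"
    unfolding run_space_def by (intro sets_pair_measure_cong refl sP)
  have E: "?E \<in> sets (run_space alg \<nu>)"
    by (intro sets.sets_Collect_finite_Ex sets_run_space_outputs_at alg \<nu>) simp
  have slice: "ennreal r ^ (T * CARD('k)) * emeasure (PiM UNIV (?M \<nu>)) (Pair u -` ?E)
      \<le> emeasure (PiM UNIV (?M \<nu>')) (Pair u -` ?E)" for u
  proof -
    let ?X = "{x \<in> space (PiM ?J (?M \<nu>)). \<exists>t\<in>{..<T}. outputs_at alg k t (u, x)}"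
    let ?Y = "{\<omega> \<in> space (seed_law alg \<Otimes>\<^sub>M PiM ?J (?M \<nu>)). \<exists>t\<in>{..<T}. outputs_at alg k t \<omega>}"
    have spc: "space (seed_law alg) = UNIV" "\<And>i. space (?M \<nu> i) = UNIV"
      using sets_eq_imp_space_eq[OF seed] sets_eq_imp_space_eq[OF setsM] by auto
    have "?Y \<in> sets (seed_law alg \<Otimes>\<^sub>M PiM ?J (?M \<nu>))"
      by (intro sets.sets_Collect_finite_Ex sets_outputs_at[OF alg seed setsM, of T]) auto
    from sets_Pair1[OF this, of u] have X: "?X \<in> sets (PiM ?J (?M \<nu>))"
      by (simp add: vimage_def space_pair_measure spc)
    have "Pair u -` ?E = prod_emb UNIV (?M \<nu>) ?J ?X"
    proof -
      \<comment> \<open>Erasing all rewards from round \<open>T\<close> on does not alter the event;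
        this is what makes the slice a cylinder.\<close>
      have "outputs_at alg k t (u, restrict x ?J) = outputs_at alg k t (u, x)" if "t < T" for t x
        using that by (intro outputs_at_cong) auto
      then show ?thesis
        by (auto simp: prod_emb_def run_space_def space_pair_measure spc space_PiM)
    qed
    moreover have "ennreal r ^ card ?J * emeasure (PiM UNIV (?M \<nu>)) (prod_emb UNIV (?M \<nu>) ?J ?X)
        \<le> emeasure (PiM UNIV (?M \<nu>')) (prod_emb UNIV (?M \<nu>) ?J ?X)"
    proof (rule emeasure_PiM_emb_dominated[OF _ prob_space_reward[OF \<nu>] prob_space_reward[OF \<nu>'] _ _ X])
      show "ennreal r * emeasure (?M \<nu> i) A \<le> emeasure (?M \<nu>' i) A" if "A \<in> sets (?M \<nu> i)" for i A
        using that dom by (cases i) (simp add: setsM)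
    qed (simp_all add: setsM)
    ultimately show ?thesis
      by (simp add: card_cartesian_product)
  qed
  have meas: "(\<lambda>u. emeasure (PiM UNIV (?M \<nu>)) (Pair u -` ?E)) \<in> borel_measurable (seed_law alg)"
    using P.measurable_emeasure_Pair[OF E[unfolded run_space_def]] unfolding run_space_def .
  have "ennreal (r ^ (T * CARD('k)) * measure (run_space alg \<nu>) ?E)
      = ennreal r ^ (T * CARD('k)) * emeasure (run_space alg \<nu>) ?E"
    using r by (simp add: R.emeasure_eq_measure ennreal_mult ennreal_power)
  also have "\<dots> = (\<integral>\<^sup>+u. ennreal r ^ (T * CARD('k)) * emeasure (PiM UNIV (?M \<nu>)) (Pair u -` ?E)
                   \<partial>seed_law alg)"
    using E meas unfolding run_space_def
    by (subst P.emeasure_pair_measure_alt) (assumption, simp only: nn_integral_cmult)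
  also have "\<dots> \<le> (\<integral>\<^sup>+u. emeasure (PiM UNIV (?M \<nu>')) (Pair u -` ?E) \<partial>seed_law alg)"
    by (intro nn_integral_mono slice)
  also have "\<dots> = emeasure (run_space alg \<nu>') ?E"
    using E unfolding sR[symmetric] by (simp add: run_space_def P'.emeasure_pair_measure_alt)
  also have "\<dots> \<le> emeasure (run_space alg \<nu>')
      {\<omega> \<in> space (run_space alg \<nu>'). stop_time alg \<omega> < \<infinity> \<and> output_arm alg \<omega> \<in> {k}}"
    using sets_eq_imp_space_eq[OF sR]
    by (intro emeasure_mono sets_run_space_output alg \<nu>')
      (unfold singleton_iff output_arm_iff_outputs_at, auto)
  also have "\<dots> = ennreal (prob_output_in alg \<nu>' {k})"
    by (simp add: prob_output_in_def R'.emeasure_eq_measure)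
  finally show ?thesis
    by (subst (asm) ennreal_le_iff) (simp_all add: prob_output_in_def)
qed


section \<open>Unsolvability\<close>

lemma good_arms_mono: "\<epsilon>1 \<le> \<epsilon>2 \<Longrightarrow> good_arms q \<epsilon>1 \<nu> \<subseteq> good_arms q \<epsilon>2 \<nu>"
  unfolding good_arms_def
  by (auto intro!: order_trans[OF ereal_minus_mono[OF order_refl, of "ereal \<epsilon>1" "ereal \<epsilon>2"]])

text \<open>Rounding the denominator up gives
  \<open>eps_tilde lam \<epsilon> c \<le> \<epsilon> / (c + 1)\<close>. This places the acceptable
  outputs among the arms of \<open>good_arms q \<epsilon> \<nu>\<close>, which are those that
  \<open>instance_gap\<close> controls.\<close>

lemma of_int_mult_eps_tilde_le:
  assumes "0 < \<epsilon>" "0 < lam" "1 \<le> c"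
  shows "of_int c * eps_tilde lam \<epsilon> c \<le> \<epsilon>"
proof -
  let ?n = "real_of_int \<lceil>of_int (c + 1) * lam / \<epsilon>\<rceil>"
  have n: "of_int (c + 1) * lam / \<epsilon> \<le> ?n"
    by (rule le_of_int_ceiling)
  moreover have "0 < of_int (c + 1) * lam / \<epsilon>"
    using assms by simp
  ultimately have "0 < ?n"
    by linarith
  have "of_int c * lam \<le> of_int (c + 1) * lam"
    using assms by (intro mult_right_mono) auto
  also have "\<dots> \<le> \<epsilon> * ?n"
    using mult_left_mono[OF n, of \<epsilon>] assms by simp
  finally show ?thesis
    using \<open>0 < ?n\<close> by (simp add: eps_tilde_def pos_divide_le_eq)
qed

text \<open>If no such arm existed, \<open>\<Delta>\<close> would be admissible in the gap of
  \<open>k\<close> for \<open>S = UNIV\<close>, where the infimum over the empty complement is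
  infinite and imposes no cap. The instance gap would then be at least
  \<open>\<Delta>\<close>.\<close>

lemma instance_gap_zeroD:
  assumes gap: "instance_gap q lam \<epsilon> c \<nu> = 0" and k: "k \<in> good_arms q \<epsilon> \<nu>" and \<Delta>: "0 < \<Delta>"
  shows "\<exists>a. a \<noteq> k \<and> upper_quantile (\<nu> k) (q - \<Delta>)
           < quantile (\<nu> a) (q + \<Delta>) - ereal (of_int c * eps_tilde lam \<epsilon> c)"
proof (rule ccontr)
  let ?r = "of_int c * eps_tilde lam \<epsilon> c"
  assume *: "\<not> ?thesis"
  have "(SUP a\<in>UNIV - {k}. quantile (\<nu> a) (q + \<Delta>)) \<le> upper_quantile (\<nu> k) (q - \<Delta>) + ereal ?r"
    using * by (intro SUP_least) (auto simp: not_less ereal_minus_le_iff add.commute)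
  then have "(SUP a\<in>UNIV - {k}. quantile (\<nu> a) (q + \<Delta>)) - ereal ?r \<le> upper_quantile (\<nu> k) (q - \<Delta>)"
    by (simp add: ereal_minus_le_iff add.commute)
  then have "ereal \<Delta> \<le> gap_good_on q lam \<epsilon> c \<nu> UNIV k"
    unfolding gap_good_on_def gap_Sup_def using \<Delta> by (auto intro!: Sup_upper exI[of _ \<Delta>])
  also have "\<dots> \<le> arm_gap q lam \<epsilon> c \<nu> k"
    using k by (auto simp: arm_gap_def intro!: SUP_upper)
  also have "\<dots> \<le> instance_gap q lam \<epsilon> c \<nu>"
    unfolding instance_gap_def using k by (rule SUP_upper)
  finally show False
    using gap \<Delta> by simp
qed

lemma exists_dominating_instance:
  fixes \<nu> :: "'k::finite \<Rightarrow> real \<Rightarrow> real"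
  assumes q: "0 < q" "q < 1" and \<nu>: "\<nu> \<in> instances q lam" and \<theta>: "0 < \<theta>" "\<theta> < 1"
    and \<eta>: "0 < \<eta>" "\<And>k. 0 \<le> upper_quantile (\<nu> k) (q - \<eta>)" "\<And>k. quantile (\<nu> k) (q + \<eta>) \<le> ereal lam"
    and comp: "\<And>\<Delta>. 0 < \<Delta> \<Longrightarrow>
        \<exists>a. a \<noteq> k \<and> upper_quantile (\<nu> k) (q - \<Delta>) < quantile (\<nu> a) (q + \<Delta>) - ereal r"
  shows "\<exists>\<nu>'\<in>instances q lam. k \<notin> good_arms q r \<nu>' \<and>
     (\<forall>j. \<forall>A\<in>sets borel. ennreal (1 - \<theta>) * emeasure (interval_measure (\<nu> j)) A
                            \<le> emeasure (interval_measure (\<nu>' j)) A)"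
proof -
  \<comment> \<open>The bound by \<open>\<eta>\<close> keeps the two new quantiles in
    \<open>[0, lam]\<close>, hence finite; the other bound is the one required by
    \<open>quantile_contaminate\<close>.\<close>
  define \<Delta> where "\<Delta> = min \<eta> (\<theta> * q * (1 - q))"
  have \<Delta>: "0 < \<Delta>" "\<Delta> \<le> \<eta>" "\<Delta> \<le> \<theta> * q * (1 - q)"
    using q \<theta> \<eta> by (auto simp: \<Delta>_def)
  obtain a where a: "a \<noteq> k" "upper_quantile (\<nu> k) (q - \<Delta>) < quantile (\<nu> a) (q + \<Delta>) - ereal r"
    using comp[OF \<Delta>(1)] by blast
  have cdf: "is_cdf (\<nu> j)" and range: "0 \<le> quantile (\<nu> j) q" "quantile (\<nu> j) q \<le> ereal lam" for j
    using \<nu> by (auto simp: instances_def)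
  have mono: "mono (\<nu> j)" for j
    using cdf by (simp add: is_cdf_def)
  have x: "0 \<le> upper_quantile (\<nu> k) (q - \<Delta>)" "upper_quantile (\<nu> k) (q - \<Delta>) \<le> ereal lam"
    using \<eta>(2)[of k] upper_quantile_mono[of "q - \<eta>" "q - \<Delta>" "\<nu> k"]
      upper_quantile_le_quantile[of "q - \<Delta>" q "\<nu> k"] range[of k] \<Delta>
    by (auto intro: order_trans)
  have y: "0 \<le> quantile (\<nu> a) (q + \<Delta>)" "quantile (\<nu> a) (q + \<Delta>) \<le> ereal lam"
    using \<eta>(3)[of a] quantile_mono[of q "q + \<Delta>" "\<nu> a"]
      quantile_mono[of "q + \<Delta>" "q + \<eta>" "\<nu> a"] range[of a] \<Delta>
    by (auto intro: order_trans)
  obtain x0 where x0: "upper_quantile (\<nu> k) (q - \<Delta>) = ereal x0"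
    using x by (cases "upper_quantile (\<nu> k) (q - \<Delta>)") auto
  obtain y0 where y0: "quantile (\<nu> a) (q + \<Delta>) = ereal y0"
    using y by (cases "quantile (\<nu> a) (q + \<Delta>)") auto
  define \<nu>' where "\<nu>' j = (if j = k then contaminate \<theta> x0 (\<nu> j)
                        else if j = a then contaminate \<theta> y0 (\<nu> j) else \<nu> j)" for j
  have Qk: "quantile (\<nu>' k) q = ereal x0"
  proof -
    \<comment> \<open>The CDF of arm \<open>k\<close> crosses level \<open>q - \<Delta>\<close> at
      \<open>x0\<close>, at the lower end of the bracket that contamination tolerates; arm
      \<open>a\<close> crosses \<open>q + \<Delta>\<close> at \<open>y0\<close>, at the upper
      end.\<close>
    have "\<nu> k x < q + \<Delta>" if "x < x0" for x
      using less_upper_quantileD[OF mono, of x k "q - \<Delta>"] that x0 \<Delta> by simp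
    moreover have "q - \<Delta> \<le> \<nu> k x" if "x0 < x" for x
      using upper_quantile_lessD[of "\<nu> k" "q - \<Delta>" x] that x0 by simp
    ultimately show ?thesis
      unfolding \<nu>'_def by (simp add: quantile_contaminate[OF q \<theta> \<Delta>(1,3)])
  qed
  have Qa: "quantile (\<nu>' a) q = ereal y0"
  proof -
    have "\<nu> a x < q + \<Delta>" if "x < y0" for x
      using less_quantileD[OF mono, of x a "q + \<Delta>"] that y0 by simp
    moreover have "q - \<Delta> \<le> \<nu> a x" if "y0 < x" for x
      using quantile_lessD[of "\<nu> a" "q + \<Delta>" x] that y0 \<Delta> by simp
    ultimately show ?thesis
      unfolding \<nu>'_def using a by (simp add: quantile_contaminate[OF q \<theta> \<Delta>(1,3)])
  qed
  have "is_cdf (\<nu>' j)" for j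
    using cdf \<theta> by (simp add: \<nu>'_def is_cdf_contaminate)
  moreover have "0 \<le> quantile (\<nu>' j) q \<and> quantile (\<nu>' j) q \<le> ereal lam" for j
  proof -
    consider "j = k" | "j = a" | "j \<noteq> k" "j \<noteq> a"
      by blast
    then show ?thesis
      using Qk Qa x y x0 y0 range[of j] by cases (simp_all, simp add: \<nu>'_def)
  qed
  ultimately have "\<nu>' \<in> instances q lam"
    by (simp add: instances_def)
  moreover have "k \<notin> good_arms q r \<nu>'"
  proof -
    have "ereal x0 < quantile (\<nu>' a) q - ereal r"
      using a(2) x0 y0 Qa by simp
    also have "\<dots> \<le> (SUP j. quantile (\<nu>' j) q) - ereal r"
      by (intro ereal_minus_mono SUP_upper) auto
    finally show ?thesis
      by (simp add: good_arms_def Qk not_le)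
  qed
  moreover have "ennreal (1 - \<theta>) * emeasure (interval_measure (\<nu> j)) A
      \<le> emeasure (interval_measure (\<nu>' j)) A" if "A \<in> sets borel" for j A
  proof -
    \<comment> \<open>For the arms left unchanged the domination is just
      \<open>1 - \<theta> \<le> 1\<close>.\<close>
    have "ennreal (1 - \<theta>) * emeasure (interval_measure (\<nu> j)) A
        \<le> 1 * emeasure (interval_measure (\<nu> j)) A"
      using \<theta> by (intro mult_right_mono) auto
    then show ?thesis
      using emeasure_interval_measure_contaminate[OF cdf _ _ that, of \<theta>] \<theta>
      by (simp add: \<nu>'_def)
  qed
  ultimately show ?thesis
    by blast
qed

theorem theorem21:
  fixes \<nu> :: "'k::finite \<Rightarrow> real \<Rightarrow> real"
    and lam \<epsilon> q :: real and c :: int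
  assumes "CARD('k) \<ge> 2"
    and "0 < \<epsilon>" and "\<epsilon> < lam"
    and "0 < q" and "q < 1"
    and "c \<ge> 1"
    and "\<nu> \<in> instances q lam"
    and "instance_gap q lam \<epsilon> c \<nu> = 0"
    and "\<exists>\<eta>\<^sub>0>0. \<forall>k. 0 \<le> upper_quantile (\<nu> k) (q - \<eta>\<^sub>0) \<and>
           upper_quantile (\<nu> k) (q - \<eta>\<^sub>0) \<le> quantile (\<nu> k) (q + \<eta>\<^sub>0) \<and>
           quantile (\<nu> k) (q + \<eta>\<^sub>0) \<le> ereal lam"
  shows "unsolvable q lam (of_int c * eps_tilde lam \<epsilon> c) \<nu>"
  unfolding unsolvable_def
proof (intro conjI notI)
  show "\<nu> \<in> instances q lam" by fact
  let ?r = "of_int c * eps_tilde lam \<epsilon> c"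
  let ?K = "real CARD('k)"
  \<comment> \<open>Chosen so that \<open>(?K + 1) * \<delta> < 1\<close>, which contradicts the
    final estimate \<open>1 - \<delta> \<le> ?K * \<delta>\<close>.\<close>
  define \<delta> where "\<delta> = 1 / (?K + 2)"
  have \<delta>: "0 < \<delta>" "\<delta> < 1"
    by (auto simp: \<delta>_def)
  assume "solvable q lam ?r \<nu>"
  then obtain alg :: "'k algorithm" where alg: "valid_algorithm alg" "reliable q lam ?r \<delta> alg"
      "1 - \<delta> \<le> prob_output_in alg \<nu> (good_arms q ?r \<nu>)"
    using \<delta> unfolding solvable_def by blast
  obtain \<eta> where \<eta>: "0 < \<eta>" "\<And>k. 0 \<le> upper_quantile (\<nu> k) (q - \<eta>)"
      "\<And>k. quantile (\<nu> k) (q + \<eta>) \<le> ereal lam"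
    using assms(9) by blast
  have cdf: "is_cdf (\<nu> k)" for k
    using assms(7) by (simp add: instances_def)
  have sub: "good_arms q ?r \<nu> \<subseteq> good_arms q \<epsilon> \<nu>"
    using assms by (intro good_arms_mono of_int_mult_eps_tilde_le) auto
  have single: "prob_output_in alg \<nu> {k} \<le> \<delta>" if k: "k \<in> good_arms q ?r \<nu>" for k
  proof (rule prob_output_in_singleton_le[OF alg(1) cdf])
    fix T
    let ?p = "measure (run_space alg \<nu>) {\<omega> \<in> space (run_space alg \<nu>). \<exists>t\<in>{..<T}. outputs_at alg k t \<omega>}"
    \<comment> \<open>The alternative instance varies with \<open>\<theta>\<close>, whereas the
      algorithm, \<open>T\<close> and \<open>?p\<close> do not; this allows the limit in
      \<open>\<theta>\<close> below.\<close>
    have "(1 - \<theta>) ^ (T * CARD('k)) * ?p \<le> \<delta>" if \<theta>: "0 < \<theta>" "\<theta> < 1" for \<theta>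
    proof -
      obtain \<nu>' where \<nu>': "\<nu>' \<in> instances q lam" "k \<notin> good_arms q ?r \<nu>'"
          "\<And>j A. A \<in> sets borel \<Longrightarrow> ennreal (1 - \<theta>) * emeasure (interval_measure (\<nu> j)) A
                            \<le> emeasure (interval_measure (\<nu>' j)) A"
        using exists_dominating_instance[OF assms(4,5,7) \<theta> \<eta> instance_gap_zeroD[OF assms(8)]] k sub
        by blast
      have cdf': "is_cdf (\<nu>' j)" for j
        using \<nu>'(1) by (simp add: instances_def)
      have "(1 - \<theta>) ^ (T * CARD('k)) * ?p \<le> prob_output_in alg \<nu>' {k}"
        using \<theta> by (intro measure_run_space_outputs_dominated alg cdf cdf' \<nu>'(3)) auto
      \<comment> \<open>Under \<open>\<nu>'\<close> the output \<open>k\<close> is an error, so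
        reliability bounds its probability.\<close>
      also have "\<dots> \<le> prob_output_in alg \<nu>' (- good_arms q ?r \<nu>')"
        using \<nu>'(2) by (intro prob_output_in_mono alg cdf') auto
      also have "\<dots> \<le> \<delta>"
        using alg(2) \<nu>'(1) by (simp add: reliable_def)
      finally show ?thesis .
    qed
    then have "\<forall>\<^sub>F \<theta> in at_right 0. (1 - \<theta>) ^ (T * CARD('k)) * ?p \<le> \<delta>"
      by (auto simp: eventually_at_right_field intro!: exI[of _ 1])
    moreover have "((\<lambda>\<theta>. (1 - \<theta>) ^ (T * CARD('k)) * ?p) \<longlongrightarrow> (1 - 0) ^ (T * CARD('k)) * ?p)
        (at_right 0)"
      by (intro tendsto_intros)
    ultimately show "?p \<le> \<delta>"
      using tendsto_upperbound[of _ _ "at_right (0::real)" \<delta>] by fastforce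
  qed
  have "1 - \<delta> \<le> (\<Sum>k\<in>good_arms q ?r \<nu>. prob_output_in alg \<nu> {k})"
    using alg(3) prob_output_in_le_sum[OF alg(1) cdf] by (rule order_trans)
  also have "\<dots> \<le> real (card (good_arms q ?r \<nu>)) * \<delta>"
    by (rule sum_bounded_above[OF single])
  also have "\<dots> \<le> ?K * \<delta>"
    using \<delta> by (intro mult_right_mono) (auto intro: card_mono)
  finally show False
    by (simp add: \<delta>_def field_simps)
qed

end
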